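(* Let $X\in\mathbb{R}^{n\times p}$ have columns in general position, $\beta_0\in\mathbb{R}^p$, $\varepsilon\in\mathbb{R}^n$, $y=X\beta_0+\varepsilon$, $\lambda_{\mathrm L}>0$, let $E$ and $s$ be the Lasso equicorrelation set and equicorrelation sign vector, let $q\ge0$ be an integer and $A\in\mathbb{R}^{q\times|E|}$. Let $\hat\delta_A$ be the generalized correction and $\hat\beta_A=\hat\beta_{\mathrm L}+\hat\delta_A$. Then the prediction improvement $$\Delta(\hat\beta_{\mathrm L},\hat\beta_A)=\frac1n\|X\hat\beta_{\mathrm L}-X\beta_0\|_2^2-\frac1n\|X\hat\beta_A-X\beta_0\|_2^2$$ satisfies $$\Delta(\hat\beta_{\mathrm L},\hat\beta_A)=2\lambda_{\mathrm L}\langle\hat\delta_{A,E},s\rangle-\frac1n\langle X_E\hat\delta_{A,E},X_E\hat\delta_{A,E}\rangle-\frac2n\langle X_E\hat\delta_{A,E},\varepsilon\rangle .$$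
   Context: Notation: $X_S$ is the submatrix of columns of $X$ indexed by $S\subseteq\{1,\dots,p\}$; $v_S$, $v_{-S}$ are the subvectors of $v$ indexed by $S$ and its complement. Zero-dimensional vectors and matrices are allowed (so the case $E=\varnothing$ is included, with all inner products equal to zero). General position: for every integer $0\le k<\min\{n,p\}$, no $k$-dimensional affine subspace of $\mathbb{R}^n$ contains more than $k+1$ elements of $\{\pm X_1,\dots,\pm X_p\}$, excluding antipodal pairs (i.e. for any distinct indices $i_1,\dots,i_{k+2}$ and any signs $\sigma_1,\dots,\sigma_{k+2}\in\{\pm1\}$, the vectors $\sigma_1X_{i_1},\dots,\sigma_{k+2}X_{i_{k+2}}$ do not all lie in a $k$-dimensional affine subspace). Under general position the Lasso minimizer below is unique and $X_E$ has full column rank. Lasso: $\hat\beta_{\mathrm L}=\arg\min_{\beta\in\mathbb{R}^p}\{\frac1{2n}\|y-X\beta\|_2^2+\lambda_{\mathrm L}\|\beta\|_1\}$. Equicorrelation set: $E=\{j:|\frac1nX_j^\top(y-X\hat\beta_{\mathrm L})|=\lambda_{\mathrm L}\}$. Sign vector: $s=\operatorname{sign}(X_E^\top(y-X\hat\beta_{\mathrm L}))\in\{-1,1\}^{|E|}$. Generalized correction: $\hat\delta_A$ is the minimizer over $\delta\in\mathbb{R}^p$ with $\delta_{-E}=0$ of $\frac1{2n}\|y-X\hat\beta_{\mathrm L}-X\delta\|_2^2+\frac12\|A\delta_E\|_2^2$, and $\hat\delta_{A,E}$ is its restriction to $E$. *)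

theory Defs
  imports "HOL-Analysis.Analysis"
begin

text \<open>
  The design matrix is \<open>X :: real ^ 'p ^ 'n\<close>, with \<open>n = CARD('n)\<close> rows and \<open>p = CARD('p)\<close> columns.
  Since \<open>E\<close> is a set of column indices determined by the data, vectors of dimension \<open>|S|\<close> for
  \<open>S :: 'p set\<close> are functions on \<open>S\<close> (undefined outside \<open>S\<close>), and a \<open>q \<times> |S|\<close> matrix is a function
  \<open>A\<close> of which only the entries \<open>A i j\<close> with \<open>i < q\<close> and \<open>j \<in> S\<close> are used. This
  includes the cases \<open>q = 0\<close> and \<open>S = {}\<close>, where all sums are empty.
\<close>

definition subvec :: "real ^ 'p \<Rightarrow> 'p set \<Rightarrow> 'p \<Rightarrow> real" where
  "subvec v S = (\<lambda>j\<in>S. v $ j)"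

definition inner_on :: "'p set \<Rightarrow> ('p \<Rightarrow> real) \<Rightarrow> ('p \<Rightarrow> real) \<Rightarrow> real" where
  "inner_on S u v = (\<Sum>j\<in>S. u j * v j)"

text \<open>\<open>subcols_mult X S u\<close> is the product of the column submatrix \<open>X\<^sub>S\<close> with \<open>u\<close>.\<close>

definition subcols_mult :: "real ^ 'p ^ 'n \<Rightarrow> 'p set \<Rightarrow> ('p \<Rightarrow> real) \<Rightarrow> real ^ 'n" where
  "subcols_mult X S u = (\<Sum>j\<in>S. u j *\<^sub>R column j X)"

text \<open>The squared Euclidean norm of \<open>A u\<close> for a \<open>q \<times> |S|\<close> matrix \<open>A\<close>.\<close>

definition sq_norm_mult :: "nat \<Rightarrow> 'p set \<Rightarrow> (nat \<Rightarrow> 'p \<Rightarrow> real) \<Rightarrow> ('p \<Rightarrow> real) \<Rightarrow> real" where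
  "sq_norm_mult q S A u = (\<Sum>i<q. (\<Sum>j\<in>S. A i j * u j)\<^sup>2)"

text \<open>A choice of \<open>k + 2\<close> distinct indices is a set \<open>I\<close> of that cardinality, which rules out
  antipodal pairs.\<close>

definition general_position :: "real ^ 'p ^ 'n \<Rightarrow> bool" where
  "general_position X \<longleftrightarrow>
    (\<forall>k < min CARD('n) CARD('p). \<forall>I \<sigma>.
       card I = k + 2 \<longrightarrow> (\<forall>i\<in>I. \<sigma> i \<in> {-1, 1 :: real}) \<longrightarrow>
       \<not> (\<exists>L. affine L \<and> aff_dim L = int k \<and> (\<forall>i\<in>I. \<sigma> i *\<^sub>R column i X \<in> L)))"

definition lasso_objective ::
    "real ^ 'p ^ 'n \<Rightarrow> real ^ 'n \<Rightarrow> real \<Rightarrow> real ^ 'p \<Rightarrow> real" where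
  "lasso_objective X y lam \<beta> =
     1 / (2 * real CARD('n)) * (norm (y - X *v \<beta>))\<^sup>2 + lam * (\<Sum>j\<in>UNIV. \<bar>\<beta> $ j\<bar>)"

definition is_lasso :: "real ^ 'p ^ 'n \<Rightarrow> real ^ 'n \<Rightarrow> real \<Rightarrow> real ^ 'p \<Rightarrow> bool" where
  "is_lasso X y lam \<beta> \<longleftrightarrow> is_arg_min (lasso_objective X y lam) (\<lambda>_. True) \<beta>"

definition equicorrelation_set ::
    "real ^ 'p ^ 'n \<Rightarrow> real ^ 'n \<Rightarrow> real \<Rightarrow> real ^ 'p \<Rightarrow> 'p set" where
  "equicorrelation_set X y lam \<beta> =
     {j. \<bar>1 / real CARD('n) * (column j X \<bullet> (y - X *v \<beta>))\<bar> = lam}"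

definition equicorrelation_sign ::
    "real ^ 'p ^ 'n \<Rightarrow> real ^ 'n \<Rightarrow> real \<Rightarrow> real ^ 'p \<Rightarrow> 'p \<Rightarrow> real" where
  "equicorrelation_sign X y lam \<beta> =
     (\<lambda>j\<in>equicorrelation_set X y lam \<beta>. sgn (column j X \<bullet> (y - X *v \<beta>)))"

definition is_generalized_correction ::
    "real ^ 'p ^ 'n \<Rightarrow> real ^ 'n \<Rightarrow> real ^ 'p \<Rightarrow> 'p set \<Rightarrow> nat \<Rightarrow> (nat \<Rightarrow> 'p \<Rightarrow> real) \<Rightarrow>
     real ^ 'p \<Rightarrow> bool" where
  "is_generalized_correction X y \<beta> E q A \<delta> \<longleftrightarrow>
     is_arg_min
       (\<lambda>d. 1 / (2 * real CARD('n)) * (norm (y - X *v \<beta> - X *v d))\<^sup>2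
            + 1 / 2 * sq_norm_mult q E A (subvec d E))
       (\<lambda>d. \<forall>j. j \<notin> E \<longrightarrow> d $ j = 0) \<delta>"

definition prediction_improvement ::
    "real ^ 'p ^ 'n \<Rightarrow> real ^ 'p \<Rightarrow> real ^ 'p \<Rightarrow> real ^ 'p \<Rightarrow> real" where
  "prediction_improvement X \<beta>\<^sub>0 \<beta> \<beta>' =
     1 / real CARD('n) * (norm (X *v \<beta> - X *v \<beta>\<^sub>0))\<^sup>2
     - 1 / real CARD('n) * (norm (X *v \<beta>' - X *v \<beta>\<^sub>0))\<^sup>2"

end

theory Submission
  imports Defs
begin

text \<open>
  Expanding the squares, the improvement equals
  \<open>(2 \<langle>X \<delta>, r\<rangle> - 2 \<langle>X \<delta>, \<epsilon>\<rangle> - \<langle>X \<delta>, X \<delta>\<rangle>) / n\<close> with \<open>r\<close> the Lasso residual. As \<open>\<delta>\<close> is supported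
  on the equicorrelation set, where every column has inner product \<open>n \<lambda> s\<^sub>j\<close> with \<open>r\<close>, the
  residual term is \<open>2 \<lambda> \<langle>\<delta>\<^sub>E, s\<rangle>\<close>.
\<close>

text \<open>Columns outside \<open>S\<close> get coefficient zero in the expansion of
  \<open>X *v v\<close>. This lets the correction be handled as a full vector.\<close>

lemma subcols_mult_subvec:
  fixes X :: "real ^ 'p ^ 'n"
  assumes "\<And>j. j \<notin> S \<Longrightarrow> v $ j = 0"
  shows "subcols_mult X S (subvec v S) = X *v v"
proof -
  have "X *v v = (\<Sum>j\<in>UNIV. v $ j *\<^sub>R column j X)"
    by (simp add: matrix_mult_sum scalar_mult_eq_scaleR)
  also have "\<dots> = (\<Sum>j\<in>S. v $ j *\<^sub>R column j X)"
    using assms by (intro sum.mono_neutral_right) auto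
  finally show ?thesis
    by (simp add: subcols_mult_def subvec_def)
qed

text \<open>Membership fixes the absolute value of the inner product; multiplying by its sign
  recovers the value itself.\<close>

lemma equicorrelation_inner:
  fixes X :: "real ^ 'p ^ 'n"
  assumes "j \<in> equicorrelation_set X y lam \<beta>"
  shows "column j X \<bullet> (y - X *v \<beta>)
    = real CARD('n) * lam * equicorrelation_sign X y lam \<beta> j"
proof -
  let ?c = "column j X \<bullet> (y - X *v \<beta>)"
  have "\<bar>?c\<bar> = real CARD('n) * lam"
    using assms by (simp add: equicorrelation_set_def abs_mult field_simps)
  then have "?c = real CARD('n) * lam * sgn ?c"
    by (metis abs_mult_sgn)
  then show ?thesis
    using assms by (simp add: equicorrelation_sign_def)
qed

lemma subcols_mult_inner_residual:
  fixes X :: "real ^ 'p ^ 'n"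
  assumes "S \<subseteq> equicorrelation_set X y lam \<beta>"
  shows "subcols_mult X S u \<bullet> (y - X *v \<beta>)
    = real CARD('n) * lam * inner_on S u (equicorrelation_sign X y lam \<beta>)"
  unfolding subcols_mult_def inner_on_def inner_sum_left sum_distrib_left
  using assms by (intro sum.cong) (auto simp: equicorrelation_inner)

theorem mainTheorem4:
  fixes X :: "real ^ 'p ^ 'n"
    and \<beta>\<^sub>0 \<beta>L \<delta>A \<beta>A :: "real ^ 'p"
    and \<epsilon> y :: "real ^ 'n"
    and lamL :: real
    and E :: "'p set"
    and s :: "'p \<Rightarrow> real"
    and q :: nat
    and A :: "nat \<Rightarrow> 'p \<Rightarrow> real"
  assumes "general_position X"
    and "y = X *v \<beta>\<^sub>0 + \<epsilon>"
    and "lamL > 0"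
    and "is_lasso X y lamL \<beta>L"
    and "E = equicorrelation_set X y lamL \<beta>L"
    and "s = equicorrelation_sign X y lamL \<beta>L"
    and "is_generalized_correction X y \<beta>L E q A \<delta>A"
    and "\<beta>A = \<beta>L + \<delta>A"
  shows "prediction_improvement X \<beta>\<^sub>0 \<beta>L \<beta>A =
           2 * lamL * inner_on E (subvec \<delta>A E) s
           - 1 / real CARD('n) *
               (subcols_mult X E (subvec \<delta>A E) \<bullet> subcols_mult X E (subvec \<delta>A E))
           - 2 / real CARD('n) * (subcols_mult X E (subvec \<delta>A E) \<bullet> \<epsilon>)"
proof -
  let ?n = "real CARD('n)"
  define u where "u = subcols_mult X E (subvec \<delta>A E)"
  \<comment> \<open>A minimizer is feasible, and feasibility is exactly this support
    constraint.\<close>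
  have "\<And>j. j \<notin> E \<Longrightarrow> \<delta>A $ j = 0"
    using assms(7) by (simp add: is_generalized_correction_def is_arg_min_def)
  then have u: "X *v \<delta>A = u"
    unfolding u_def by (simp add: subcols_mult_subvec)
  have r: "u \<bullet> (y - X *v \<beta>L) = ?n * lamL * inner_on E (subvec \<delta>A E) s"
    unfolding u_def assms(5,6) by (rule subcols_mult_inner_residual[OF subset_refl])
  \<comment> \<open>Put \<open>a = X *v \<beta>L - X *v \<beta>\<^sub>0\<close> and let
    \<open>r\<close> be the Lasso residual. The left side is the squared norm of \<open>a\<close>
    minus that of \<open>a + u\<close>, that is
    \<open>- 2 * (u \<bullet> a) - u \<bullet> u\<close>, and the model for \<open>y\<close> gives
    \<open>a = \<epsilon> - r\<close>.\<close>
  have "(norm (X *v \<beta>L - X *v \<beta>\<^sub>0))\<^sup>2 - (norm (X *v \<beta>A - X *v \<beta>\<^sub>0))\<^sup>2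
      = 2 * (u \<bullet> (y - X *v \<beta>L)) - u \<bullet> u - 2 * (u \<bullet> \<epsilon>)"
    by (simp add: assms(2,8) u matrix_vector_right_distrib power2_norm_eq_inner
        inner_simps inner_commute algebra_simps)
  then have "prediction_improvement X \<beta>\<^sub>0 \<beta>L \<beta>A
      = 1 / ?n * (2 * (?n * lamL * inner_on E (subvec \<delta>A E) s) - u \<bullet> u - 2 * (u \<bullet> \<epsilon>))"
    unfolding prediction_improvement_def r by (simp flip: right_diff_distrib diff_divide_distrib)
  then show ?thesis
    by (simp add: u_def right_diff_distrib)
qed

end
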